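(* Let $R$ be a ring and let $M$ be an $R$-module of finite length such that the lattice $\mathcal{L}(M)$ of submodules of $M$ is infinite. Then there exist a simple $R$-module $S$ and a submodule $K \leq M$ such that $M/K$ contains a submodule isomorphic to $S^2 = S \oplus S$, and the endomorphism ring $\mathrm{End}_R(S)$ is infinite.
   Context: Rings are associative with unity (not necessarily commutative); modules are left modules. $\mathcal{L}(M)$ denotes the set of all submodules of $M$, ordered by inclusion. *)

theory Defs
  imports "HOL-Algebra.Module" "HOL-Algebra.AbelCoset"
begin

text \<open>
  The library's locale \<open>module\<close> is restricted to commutative rings. The following locale keeps its
  record type and its axioms, but over an arbitrary ring. As in the library, the fields
  \<open>mult\<close> and \<open>one\<close> of a \<open>module\<close> record carry no meaning. The library's locale \<open>submodule\<close> does not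
  assume commutativity and is used as it is.
\<close>

locale left_module = R?: ring R + M?: abelian_group M
  for R (structure) and M :: "('a, 'b, 'm) module_scheme" (structure) +
  assumes smult_closed [simp, intro]:
      "\<lbrakk>a \<in> carrier R; x \<in> carrier M\<rbrakk> \<Longrightarrow> a \<odot>\<^bsub>M\<^esub> x \<in> carrier M"
    and smult_l_distr:
      "\<lbrakk>a \<in> carrier R; b \<in> carrier R; x \<in> carrier M\<rbrakk> \<Longrightarrow>
       (a \<oplus> b) \<odot>\<^bsub>M\<^esub> x = a \<odot>\<^bsub>M\<^esub> x \<oplus>\<^bsub>M\<^esub> b \<odot>\<^bsub>M\<^esub> x"
    and smult_r_distr:
      "\<lbrakk>a \<in> carrier R; x \<in> carrier M; y \<in> carrier M\<rbrakk> \<Longrightarrow>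
       a \<odot>\<^bsub>M\<^esub> (x \<oplus>\<^bsub>M\<^esub> y) = a \<odot>\<^bsub>M\<^esub> x \<oplus>\<^bsub>M\<^esub> a \<odot>\<^bsub>M\<^esub> y"
    and smult_assoc1:
      "\<lbrakk>a \<in> carrier R; b \<in> carrier R; x \<in> carrier M\<rbrakk> \<Longrightarrow>
       (a \<otimes> b) \<odot>\<^bsub>M\<^esub> x = a \<odot>\<^bsub>M\<^esub> (b \<odot>\<^bsub>M\<^esub> x)"
    and smult_one [simp]:
      "x \<in> carrier M \<Longrightarrow> \<one> \<odot>\<^bsub>M\<^esub> x = x"

definition submodules :: "('a, 'r) ring_scheme \<Rightarrow> ('a, 'b, 'm) module_scheme \<Rightarrow> 'b set set"
  where "submodules R M = {N. submodule N R M}"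

abbreviation restrict_module ::
    "('a, 'b, 'm) module_scheme \<Rightarrow> 'b set \<Rightarrow> ('a, 'b, 'm) module_scheme"
  where "restrict_module M N \<equiv> M\<lparr>carrier := N\<rparr>"

text \<open>
  The elements of the quotient are the additive cosets of \<open>K\<close>; scalar multiplication is
  \<open>a (K + x) = K + a x\<close>, written as a union over representatives as for \<open>rcoset_mult\<close>.
\<close>

definition quot_module :: "('a, 'b, 'm) module_scheme \<Rightarrow> 'b set \<Rightarrow> ('a, 'b set) module"
  where "quot_module M K =
    \<lparr>carrier = a_rcosets\<^bsub>M\<^esub> K, mult = undefined, one = undefined,
     zero = K, add = set_add M,
     smult = (\<lambda>a X. \<Union>x\<in>X. K +>\<^bsub>M\<^esub> (a \<odot>\<^bsub>M\<^esub> x))\<rparr>"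

definition dsum_module ::
    "('a, 'b, 'm) module_scheme \<Rightarrow> ('a, 'c, 'n) module_scheme \<Rightarrow> ('a, 'b \<times> 'c) module"
  where "dsum_module M N =
    \<lparr>carrier = carrier M \<times> carrier N, mult = undefined, one = undefined,
     zero = (\<zero>\<^bsub>M\<^esub>, \<zero>\<^bsub>N\<^esub>),
     add = (\<lambda>(x, y) (x', y'). (x \<oplus>\<^bsub>M\<^esub> x', y \<oplus>\<^bsub>N\<^esub> y')),
     smult = (\<lambda>a (x, y). (a \<odot>\<^bsub>M\<^esub> x, a \<odot>\<^bsub>N\<^esub> y))\<rparr>"

definition module_hom ::
    "('a, 'r) ring_scheme \<Rightarrow> ('a, 'b, 'm) module_scheme \<Rightarrow> ('a, 'c, 'n) module_scheme \<Rightarrow> ('b \<Rightarrow> 'c) set"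
  where "module_hom R M N =
    {h \<in> carrier M \<rightarrow> carrier N.
      (\<forall>x\<in>carrier M. \<forall>y\<in>carrier M. h (x \<oplus>\<^bsub>M\<^esub> y) = h x \<oplus>\<^bsub>N\<^esub> h y) \<and>
      (\<forall>a\<in>carrier R. \<forall>x\<in>carrier M. h (a \<odot>\<^bsub>M\<^esub> x) = a \<odot>\<^bsub>N\<^esub> h x)}"

definition module_iso ::
    "('a, 'r) ring_scheme \<Rightarrow> ('a, 'b, 'm) module_scheme \<Rightarrow> ('a, 'c, 'n) module_scheme \<Rightarrow> ('b \<Rightarrow> 'c) set"
  where "module_iso R M N = {h \<in> module_hom R M N. bij_betw h (carrier M) (carrier N)}"

definition isomorphic_modules ::
    "('a, 'r) ring_scheme \<Rightarrow> ('a, 'b, 'm) module_scheme \<Rightarrow> ('a, 'c, 'n) module_scheme \<Rightarrow> bool"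
  where "isomorphic_modules R M N \<longleftrightarrow> module_iso R M N \<noteq> {}"

text \<open>
  Endomorphisms are taken to be extensional, that is, \<open>undefined\<close> outside the carrier.
  Otherwise the carrier could be infinite merely because of arbitrary values there.
\<close>

definition End_ring :: "('a, 'r) ring_scheme \<Rightarrow> ('a, 'b, 'm) module_scheme \<Rightarrow> ('b \<Rightarrow> 'b) ring"
  where "End_ring R M =
    \<lparr>carrier = module_hom R M M \<inter> extensional (carrier M),
     mult = compose (carrier M),
     one = (\<lambda>x\<in>carrier M. x),
     zero = (\<lambda>x\<in>carrier M. \<zero>\<^bsub>M\<^esub>),
     add = (\<lambda>f g. \<lambda>x\<in>carrier M. f x \<oplus>\<^bsub>M\<^esub> g x)\<rparr>"

definition simple_module :: "('a, 'r) ring_scheme \<Rightarrow> ('a, 'b, 'm) module_scheme \<Rightarrow> bool"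
  where "simple_module R S \<longleftrightarrow>
    left_module R S \<and> carrier S \<noteq> {\<zero>\<^bsub>S\<^esub>} \<and>
    (\<forall>N\<in>submodules R S. N = {\<zero>\<^bsub>S\<^esub>} \<or> N = carrier S)"

definition composition_series ::
    "('a, 'r) ring_scheme \<Rightarrow> ('a, 'b, 'm) module_scheme \<Rightarrow> nat \<Rightarrow> (nat \<Rightarrow> 'b set) \<Rightarrow> bool"
  where "composition_series R M n N \<longleftrightarrow>
    (\<forall>i\<le>n. N i \<in> submodules R M) \<and> N 0 = {\<zero>\<^bsub>M\<^esub>} \<and> N n = carrier M \<and>
    (\<forall>i<n. N i \<subseteq> N (Suc i) \<and>
      simple_module R (quot_module (restrict_module M (N (Suc i))) (N i)))"

definition finite_length :: "('a, 'r) ring_scheme \<Rightarrow> ('a, 'b, 'm) module_scheme \<Rightarrow> bool"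
  where "finite_length R M \<longleftrightarrow> left_module R M \<and> (\<exists>n N. composition_series R M n N)"

text \<open>The constructions above yield modules and rings.\<close>

context left_module
begin

lemma submoduleD:
  assumes "submodule K R M"
  shows "K \<subseteq> carrier M" "\<zero>\<^bsub>M\<^esub> \<in> K"
    "\<And>x y. x \<in> K \<Longrightarrow> y \<in> K \<Longrightarrow> x \<oplus>\<^bsub>M\<^esub> y \<in> K"
    "\<And>x. x \<in> K \<Longrightarrow> \<ominus>\<^bsub>M\<^esub> x \<in> K"
    "\<And>a x. a \<in> carrier R \<Longrightarrow> x \<in> K \<Longrightarrow> a \<odot>\<^bsub>M\<^esub> x \<in> K"
proof -
  interpret K: submodule K R M by (fact assms)
  show "K \<subseteq> carrier M" "\<zero>\<^bsub>M\<^esub> \<in> K"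
    "\<And>x y. x \<in> K \<Longrightarrow> y \<in> K \<Longrightarrow> x \<oplus>\<^bsub>M\<^esub> y \<in> K"
    "\<And>x. x \<in> K \<Longrightarrow> \<ominus>\<^bsub>M\<^esub> x \<in> K"
    "\<And>a x. a \<in> carrier R \<Longrightarrow> x \<in> K \<Longrightarrow> a \<odot>\<^bsub>M\<^esub> x \<in> K"
    using K.subset K.one_closed K.m_closed K.m_inv_closed K.smult_closed
    by (auto simp: a_inv_def)
qed

lemma submodule_abelian_subgroup:
  assumes "submodule K R M"
  shows "abelian_subgroup K M"
proof -
  interpret K: submodule K R M by (fact assms)
  show ?thesis
    by (rule abelian_subgroupI3)
      (auto intro: additive_subgroup.intro K.subgroup_axioms M.abelian_group_axioms)
qed

lemma quot_smult:
  assumes K: "submodule K R M" and a: "a \<in> carrier R" and x: "x \<in> carrier M"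
  shows "a \<odot>\<^bsub>quot_module M K\<^esub> (K +>\<^bsub>M\<^esub> x) = K +>\<^bsub>M\<^esub> (a \<odot>\<^bsub>M\<^esub> x)"
proof -
  interpret A: abelian_subgroup K M by (rule submodule_abelian_subgroup[OF K])
  have "K +>\<^bsub>M\<^esub> (a \<odot>\<^bsub>M\<^esub> y) = K +>\<^bsub>M\<^esub> (a \<odot>\<^bsub>M\<^esub> x)" if y: "y \<in> K +>\<^bsub>M\<^esub> x" for y
  proof -
    obtain k where k: "k \<in> K" "y = k \<oplus>\<^bsub>M\<^esub> x"
      using y by (auto simp: a_r_coset_def')
    have kc: "k \<in> carrier M" using k submoduleD(1)[OF K] by auto
    have "a \<odot>\<^bsub>M\<^esub> y = a \<odot>\<^bsub>M\<^esub> k \<oplus>\<^bsub>M\<^esub> a \<odot>\<^bsub>M\<^esub> x"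
      using k kc a x by (simp add: smult_r_distr)
    moreover have "a \<odot>\<^bsub>M\<^esub> k \<in> K" using submoduleD(5)[OF K] a k by auto
    ultimately have "a \<odot>\<^bsub>M\<^esub> y \<in> K +>\<^bsub>M\<^esub> (a \<odot>\<^bsub>M\<^esub> x)"
      by (auto simp: a_r_coset_def')
    then show ?thesis
      using A.a_repr_independence'[OF _ smult_closed[OF a x]] by simp
  qed
  moreover have "x \<in> K +>\<^bsub>M\<^esub> x" using A.a_rcos_self x by auto
  ultimately have "(\<Union>y\<in>K +>\<^bsub>M\<^esub> x. K +>\<^bsub>M\<^esub> (a \<odot>\<^bsub>M\<^esub> y)) = K +>\<^bsub>M\<^esub> (a \<odot>\<^bsub>M\<^esub> x)"
    by blast
  then show ?thesis by (simp add: quot_module_def)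
qed

lemma quot_left_module:
  assumes K: "submodule K R M"
  shows "left_module R (quot_module M K)"
proof -
  interpret A: abelian_subgroup K M by (rule submodule_abelian_subgroup[OF K])
  let ?Q = "quot_module M K"
  note sm = quot_smult[OF K]
  have car: "carrier ?Q = (\<lambda>x. K +>\<^bsub>M\<^esub> x) ` carrier M"
    by (auto simp: quot_module_def A_RCOSETS_def')
  have add: "(K +>\<^bsub>M\<^esub> x) \<oplus>\<^bsub>?Q\<^esub> (K +>\<^bsub>M\<^esub> y) = K +>\<^bsub>M\<^esub> (x \<oplus>\<^bsub>M\<^esub> y)"
    if "x \<in> carrier M" "y \<in> carrier M" for x y
    using A.a_rcos_sum that by (simp add: quot_module_def)
  have zero: "\<zero>\<^bsub>?Q\<^esub> = K +>\<^bsub>M\<^esub> \<zero>\<^bsub>M\<^esub>"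
    using submoduleD(1)[OF K] by (auto simp: quot_module_def a_r_coset_def')
  have "abelian_group ?Q"
  proof (rule abelian_groupI)
    show "\<And>x. x \<in> carrier ?Q \<Longrightarrow> \<exists>y\<in>carrier ?Q. y \<oplus>\<^bsub>?Q\<^esub> x = \<zero>\<^bsub>?Q\<^esub>"
      unfolding car zero by (auto simp: add) (metis M.a_inv_closed M.l_neg)
  next
    fix X Y Z assume "X \<in> carrier ?Q" "Y \<in> carrier ?Q" "Z \<in> carrier ?Q"
    then obtain x y z where xyz: "x \<in> carrier M" "y \<in> carrier M" "z \<in> carrier M"
      and X: "X = K +>\<^bsub>M\<^esub> x" and Y: "Y = K +>\<^bsub>M\<^esub> y" and Z: "Z = K +>\<^bsub>M\<^esub> z"
      by (auto simp: car)
    show "X \<oplus>\<^bsub>?Q\<^esub> Y \<oplus>\<^bsub>?Q\<^esub> Z = X \<oplus>\<^bsub>?Q\<^esub> (Y \<oplus>\<^bsub>?Q\<^esub> Z)"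
      using xyz by (simp add: X Y Z add M.a_assoc)
    show "X \<oplus>\<^bsub>?Q\<^esub> Y = Y \<oplus>\<^bsub>?Q\<^esub> X"
      using xyz by (simp add: X Y add M.a_comm)
  qed (auto simp: car add zero)
  then show ?thesis
    by (intro left_module.intro left_module_axioms.intro R.ring_axioms)
      (auto simp: car add sm smult_l_distr smult_r_distr smult_assoc1)
qed

lemma dsum_left_module:
  assumes "left_module R N"
  shows "left_module R (dsum_module M N)"
proof -
  interpret N: left_module R N by (fact assms)
  have "abelian_group (dsum_module M N)"
  proof (rule abelian_groupI)
    fix x assume "x \<in> carrier (dsum_module M N)"
    then show "\<exists>y\<in>carrier (dsum_module M N). y \<oplus>\<^bsub>dsum_module M N\<^esub> x = \<zero>\<^bsub>dsum_module M N\<^esub>"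
      by (intro bexI[of _ "(\<ominus>\<^bsub>M\<^esub> fst x, \<ominus>\<^bsub>N\<^esub> snd x)"])
        (auto simp: dsum_module_def M.l_neg N.l_neg)
  next
    fix x y assume "x \<in> carrier (dsum_module M N)" "y \<in> carrier (dsum_module M N)"
    then show "x \<oplus>\<^bsub>dsum_module M N\<^esub> y = y \<oplus>\<^bsub>dsum_module M N\<^esub> x"
      by (auto simp: dsum_module_def M.a_comm N.a_comm)
  qed (auto simp: dsum_module_def M.a_assoc N.a_assoc)
  then show ?thesis
    by (intro left_module.intro left_module_axioms.intro R.ring_axioms)
      (auto simp: dsum_module_def smult_l_distr smult_r_distr smult_assoc1
        N.smult_l_distr N.smult_r_distr N.smult_assoc1)
qed

lemma smult_r_null [simp]:
  assumes "a \<in> carrier R"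
  shows "a \<odot>\<^bsub>M\<^esub> \<zero>\<^bsub>M\<^esub> = \<zero>\<^bsub>M\<^esub>"
proof -
  have "a \<odot>\<^bsub>M\<^esub> \<zero>\<^bsub>M\<^esub> \<oplus>\<^bsub>M\<^esub> a \<odot>\<^bsub>M\<^esub> \<zero>\<^bsub>M\<^esub> = a \<odot>\<^bsub>M\<^esub> \<zero>\<^bsub>M\<^esub>"
    using smult_r_distr[OF assms M.zero_closed M.zero_closed] by simp
  then show ?thesis using M.add.l_cancel_one assms by simp
qed

lemma smult_r_minus:
  assumes "a \<in> carrier R" "x \<in> carrier M"
  shows "a \<odot>\<^bsub>M\<^esub> (\<ominus>\<^bsub>M\<^esub> x) = \<ominus>\<^bsub>M\<^esub> (a \<odot>\<^bsub>M\<^esub> x)"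
proof (rule M.minus_equality[symmetric])
  show "a \<odot>\<^bsub>M\<^esub> (\<ominus>\<^bsub>M\<^esub> x) \<oplus>\<^bsub>M\<^esub> a \<odot>\<^bsub>M\<^esub> x = \<zero>\<^bsub>M\<^esub>"
    using assms smult_r_distr[of a "\<ominus>\<^bsub>M\<^esub> x" x] by (simp add: M.l_neg)
qed (use assms in auto)

lemma End_ring_eqI:
  assumes "f \<in> carrier (End_ring R M)" "g \<in> carrier (End_ring R M)"
    and "\<And>x. x \<in> carrier M \<Longrightarrow> f x = g x"
  shows "f = g"
  using assms by (auto simp: End_ring_def intro: extensionalityI)

lemma End_ring_apply:
  assumes "f \<in> carrier (End_ring R M)" "x \<in> carrier M"
  shows "f x \<in> carrier M"
    "\<And>y. y \<in> carrier M \<Longrightarrow> f (x \<oplus>\<^bsub>M\<^esub> y) = f x \<oplus>\<^bsub>M\<^esub> f y"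
    "\<And>a. a \<in> carrier R \<Longrightarrow> f (a \<odot>\<^bsub>M\<^esub> x) = a \<odot>\<^bsub>M\<^esub> f x"
  using assms by (auto simp: End_ring_def module_hom_def)

lemma End_ring_memI:
  assumes "\<And>x. x \<in> carrier M \<Longrightarrow> f x \<in> carrier M"
    and "\<And>x y. x \<in> carrier M \<Longrightarrow> y \<in> carrier M \<Longrightarrow> f (x \<oplus>\<^bsub>M\<^esub> y) = f x \<oplus>\<^bsub>M\<^esub> f y"
    and "\<And>a x. a \<in> carrier R \<Longrightarrow> x \<in> carrier M \<Longrightarrow> f (a \<odot>\<^bsub>M\<^esub> x) = a \<odot>\<^bsub>M\<^esub> f x"
  shows "(\<lambda>x\<in>carrier M. f x) \<in> carrier (End_ring R M)"
  using assms by (auto simp: End_ring_def module_hom_def)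

lemma End_ring_op_apply:
  assumes "x \<in> carrier M"
  shows "(f \<oplus>\<^bsub>End_ring R M\<^esub> g) x = f x \<oplus>\<^bsub>M\<^esub> g x"
    and "(f \<otimes>\<^bsub>End_ring R M\<^esub> g) x = f (g x)"
    and "\<zero>\<^bsub>End_ring R M\<^esub> x = \<zero>\<^bsub>M\<^esub>"
    and "\<one>\<^bsub>End_ring R M\<^esub> x = x"
  using assms by (simp_all add: End_ring_def compose_eq)

lemma End_ring_closed:
  shows "\<zero>\<^bsub>End_ring R M\<^esub> \<in> carrier (End_ring R M)"
    and "\<one>\<^bsub>End_ring R M\<^esub> \<in> carrier (End_ring R M)"
    and "\<lbrakk>f \<in> carrier (End_ring R M); g \<in> carrier (End_ring R M)\<rbrakk> \<Longrightarrow>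
      f \<otimes>\<^bsub>End_ring R M\<^esub> g \<in> carrier (End_ring R M)"
    and "\<lbrakk>f \<in> carrier (End_ring R M); g \<in> carrier (End_ring R M)\<rbrakk> \<Longrightarrow>
      f \<oplus>\<^bsub>End_ring R M\<^esub> g \<in> carrier (End_ring R M)"
proof -
  let ?E = "End_ring R M"
  have e: "\<zero>\<^bsub>?E\<^esub> = (\<lambda>x\<in>carrier M. \<zero>\<^bsub>M\<^esub>)" "\<one>\<^bsub>?E\<^esub> = (\<lambda>x\<in>carrier M. x)"
    "f \<otimes>\<^bsub>?E\<^esub> g = (\<lambda>x\<in>carrier M. f (g x))"
    "f \<oplus>\<^bsub>?E\<^esub> g = (\<lambda>x\<in>carrier M. f x \<oplus>\<^bsub>M\<^esub> g x)"
    by (simp_all add: End_ring_def compose_def)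
  show "\<zero>\<^bsub>?E\<^esub> \<in> carrier ?E" "\<one>\<^bsub>?E\<^esub> \<in> carrier ?E"
    unfolding e by (rule End_ring_memI; simp)+
  assume f: "f \<in> carrier ?E" and g: "g \<in> carrier ?E"
  note fg = End_ring_apply[OF f] End_ring_apply[OF g]
  show "f \<otimes>\<^bsub>?E\<^esub> g \<in> carrier ?E"
    unfolding e by (rule End_ring_memI) (simp_all add: fg)
  show "f \<oplus>\<^bsub>?E\<^esub> g \<in> carrier ?E"
    unfolding e by (rule End_ring_memI) (simp_all add: fg M.a_ac smult_r_distr)
qed

lemma End_ring_is_ring: "ring (End_ring R M)"
proof (rule ringI)
  let ?E = "End_ring R M"
  note closed = End_ring_closed
  show "abelian_group ?E"
  proof (rule abelian_groupI)
    fix f assume f: "f \<in> carrier ?E"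
    let ?g = "\<lambda>x\<in>carrier M. \<ominus>\<^bsub>M\<^esub> f x"
    have g: "?g \<in> carrier ?E"
      by (rule End_ring_memI) (simp_all add: End_ring_apply[OF f] M.minus_add smult_r_minus)
    have "?g \<oplus>\<^bsub>?E\<^esub> f = \<zero>\<^bsub>?E\<^esub>"
      by (rule End_ring_eqI[OF closed(4)[OF g f] closed(1)])
        (simp add: End_ring_op_apply End_ring_apply[OF f] M.l_neg)
    with g show "\<exists>g\<in>carrier ?E. g \<oplus>\<^bsub>?E\<^esub> f = \<zero>\<^bsub>?E\<^esub>" by blast
    show "\<zero>\<^bsub>?E\<^esub> \<oplus>\<^bsub>?E\<^esub> f = f"
      by (rule End_ring_eqI[OF closed(4)[OF closed(1) f] f])
        (simp add: End_ring_op_apply End_ring_apply[OF f])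
    fix g assume g: "g \<in> carrier ?E"
    show "f \<oplus>\<^bsub>?E\<^esub> g = g \<oplus>\<^bsub>?E\<^esub> f"
      by (rule End_ring_eqI[OF closed(4)[OF f g] closed(4)[OF g f]])
        (simp add: End_ring_op_apply End_ring_apply[OF f] End_ring_apply[OF g] M.a_comm)
    fix h assume h: "h \<in> carrier ?E"
    show "f \<oplus>\<^bsub>?E\<^esub> g \<oplus>\<^bsub>?E\<^esub> h = f \<oplus>\<^bsub>?E\<^esub> (g \<oplus>\<^bsub>?E\<^esub> h)"
      by (rule End_ring_eqI[OF closed(4)[OF closed(4)[OF f g] h] closed(4)[OF f closed(4)[OF g h]]])
        (simp add: End_ring_op_apply End_ring_apply[OF f] End_ring_apply[OF g]
          End_ring_apply[OF h] M.a_assoc)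
  qed (simp_all add: closed)
  show "monoid ?E"
  proof (rule monoidI)
    fix f assume f: "f \<in> carrier ?E"
    show "\<one>\<^bsub>?E\<^esub> \<otimes>\<^bsub>?E\<^esub> f = f"
      by (rule End_ring_eqI[OF closed(3)[OF closed(2) f] f])
        (simp add: End_ring_op_apply End_ring_apply[OF f])
    show "f \<otimes>\<^bsub>?E\<^esub> \<one>\<^bsub>?E\<^esub> = f"
      by (rule End_ring_eqI[OF closed(3)[OF f closed(2)] f]) (simp add: End_ring_op_apply)
    fix g h assume g: "g \<in> carrier ?E" and h: "h \<in> carrier ?E"
    show "f \<otimes>\<^bsub>?E\<^esub> g \<otimes>\<^bsub>?E\<^esub> h = f \<otimes>\<^bsub>?E\<^esub> (g \<otimes>\<^bsub>?E\<^esub> h)"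
      by (rule End_ring_eqI[OF closed(3)[OF closed(3)[OF f g] h] closed(3)[OF f closed(3)[OF g h]]])
        (simp add: End_ring_op_apply End_ring_apply[OF h])
  qed (simp_all add: closed)
  fix f g h assume f: "f \<in> carrier ?E" and g: "g \<in> carrier ?E" and h: "h \<in> carrier ?E"
  note app = End_ring_op_apply End_ring_apply[OF f] End_ring_apply[OF g] End_ring_apply[OF h]
  show "(f \<oplus>\<^bsub>?E\<^esub> g) \<otimes>\<^bsub>?E\<^esub> h = f \<otimes>\<^bsub>?E\<^esub> h \<oplus>\<^bsub>?E\<^esub> g \<otimes>\<^bsub>?E\<^esub> h"
    by (rule End_ring_eqI[OF closed(3)[OF closed(4)[OF f g] h]
          closed(4)[OF closed(3)[OF f h] closed(3)[OF g h]]]) (simp add: app)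
  show "h \<otimes>\<^bsub>?E\<^esub> (f \<oplus>\<^bsub>?E\<^esub> g) = h \<otimes>\<^bsub>?E\<^esub> f \<oplus>\<^bsub>?E\<^esub> h \<otimes>\<^bsub>?E\<^esub> g"
    by (rule End_ring_eqI[OF closed(3)[OF h closed(4)[OF f g]]
          closed(4)[OF closed(3)[OF h f] closed(3)[OF h g]]]) (simp add: app)
qed

end

end

theory Submission
  imports Defs
begin

text \<open>
  Choose \<open>K\<close> maximal among the submodules with infinitely many submodules above them. In \<open>Q = M / K\<close>
  only finitely many submodules lie above any nonzero one, so \<open>Q\<close> has infinitely many minimal
  submodules. Fix a minimal \<open>A\<close>. Infinitely many of the other minimal submodules \<open>B\<close> have the same
  sum \<open>C = A + B\<close>. Relative to one of them, \<open>B\<^sub>0\<close>, they are the graphs of infinitely many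
  homomorphisms \<open>B\<^sub>0 \<rightarrow> A\<close>. By Schur's lemma \<open>A\<close> and \<open>B\<^sub>0\<close> are isomorphic, hence \<open>C\<close> is isomorphic
  to \<open>A \<oplus> A\<close> and \<open>End A\<close> is infinite.
\<close>

section \<open>Submodules\<close>

context left_module
begin

text \<open>The element \<open>\<zero> \<odot> x\<close> equals its own double, so it vanishes.
  Applying this to \<open>(\<ominus> \<one> \<oplus> \<one>) \<odot> x\<close> identifies negation
  with a scalar action.\<close>

lemma smult_l_minus_one:
  assumes "x \<in> carrier M"
  shows "(\<ominus> \<one>) \<odot>\<^bsub>M\<^esub> x = \<ominus>\<^bsub>M\<^esub> x"
proof (rule M.minus_equality[symmetric])
  have "\<zero> \<odot>\<^bsub>M\<^esub> x \<oplus>\<^bsub>M\<^esub> \<zero> \<odot>\<^bsub>M\<^esub> x = \<zero> \<odot>\<^bsub>M\<^esub> x"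
    using smult_l_distr[of \<zero> \<zero> x] assms by simp
  then have "\<zero> \<odot>\<^bsub>M\<^esub> x = \<zero>\<^bsub>M\<^esub>" using M.add.l_cancel_one assms by simp
  then show "(\<ominus> \<one>) \<odot>\<^bsub>M\<^esub> x \<oplus>\<^bsub>M\<^esub> x = \<zero>\<^bsub>M\<^esub>"
    using smult_l_distr[of "\<ominus> \<one>" \<one> x] assms by (simp add: R.l_neg)
qed (use assms in auto)

text \<open>Closure under negation comes from the scalar \<open>\<ominus> \<one>\<close>, so later
  proofs need not check it.\<close>

lemma submodule_closedI:
  assumes "N \<subseteq> carrier M" "\<zero>\<^bsub>M\<^esub> \<in> N"
    "\<And>x y. x \<in> N \<Longrightarrow> y \<in> N \<Longrightarrow> x \<oplus>\<^bsub>M\<^esub> y \<in> N"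
    "\<And>a x. a \<in> carrier R \<Longrightarrow> x \<in> N \<Longrightarrow> a \<odot>\<^bsub>M\<^esub> x \<in> N"
  shows "submodule N R M"
proof -
  have "\<ominus>\<^bsub>M\<^esub> x \<in> N" if "x \<in> N" for x
    using that assms(1) assms(4)[of "\<ominus> \<one>" x] smult_l_minus_one[of x] by auto
  then show ?thesis
    using assms by unfold_locales (auto simp: a_inv_def)
qed

lemma submodule_add_cancel:
  assumes N: "submodule N R M" and x: "x \<in> N" and y: "y \<in> carrier M"
    and xy: "x \<oplus>\<^bsub>M\<^esub> y \<in> N"
  shows "y \<in> N"
proof -
  have xc: "x \<in> carrier M" using submoduleD(1)[OF N] x by auto
  have "\<ominus>\<^bsub>M\<^esub> x \<oplus>\<^bsub>M\<^esub> (x \<oplus>\<^bsub>M\<^esub> y) \<in> N"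
    using submoduleD(3)[OF N submoduleD(4)[OF N x] xy] .
  then show ?thesis using xc y by (simp add: M.r_neg1)
qed

lemma zero_submodule: "submodule {\<zero>\<^bsub>M\<^esub>} R M"
  by (rule submodule_closedI) auto

lemma submodule_Int:
  assumes "submodule A R M" "submodule B R M"
  shows "submodule (A \<inter> B) R M"
  using submoduleD[OF assms(1)] submoduleD[OF assms(2)]
  by (intro submodule_closedI) auto

lemma mem_set_add:
  "z \<in> A <+>\<^bsub>M\<^esub> B \<longleftrightarrow> (\<exists>x\<in>A. \<exists>y\<in>B. z = x \<oplus>\<^bsub>M\<^esub> y)"
  by (auto simp: set_add_def')

lemma set_addI: "x \<in> A \<Longrightarrow> y \<in> B \<Longrightarrow> x \<oplus>\<^bsub>M\<^esub> y \<in> A <+>\<^bsub>M\<^esub> B"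
  by (auto simp: mem_set_add)

lemma submodule_set_add:
  assumes A: "submodule A R M" and B: "submodule B R M"
  shows "submodule (A <+>\<^bsub>M\<^esub> B) R M"
proof (rule submodule_closedI)
  note sub = subsetD[OF submoduleD(1)[OF A]] subsetD[OF submoduleD(1)[OF B]]
  show "A <+>\<^bsub>M\<^esub> B \<subseteq> carrier M" using sub by (auto simp: mem_set_add)
  show "\<zero>\<^bsub>M\<^esub> \<in> A <+>\<^bsub>M\<^esub> B"
    using submoduleD(2)[OF A] submoduleD(2)[OF B] by (force simp: mem_set_add)
  fix x y assume "x \<in> A <+>\<^bsub>M\<^esub> B" "y \<in> A <+>\<^bsub>M\<^esub> B"
  then obtain a b a' b' where *: "a \<in> A" "b \<in> B" "a' \<in> A" "b' \<in> B"
    "x = a \<oplus>\<^bsub>M\<^esub> b" "y = a' \<oplus>\<^bsub>M\<^esub> b'"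
    by (auto simp: mem_set_add)
  then have "x \<oplus>\<^bsub>M\<^esub> y = (a \<oplus>\<^bsub>M\<^esub> a') \<oplus>\<^bsub>M\<^esub> (b \<oplus>\<^bsub>M\<^esub> b')" by (simp add: sub M.a_ac)
  with * show "x \<oplus>\<^bsub>M\<^esub> y \<in> A <+>\<^bsub>M\<^esub> B"
    using submoduleD(3)[OF A] submoduleD(3)[OF B] by (simp add: set_addI)
next
  note sub = subsetD[OF submoduleD(1)[OF A]] subsetD[OF submoduleD(1)[OF B]]
  fix r x assume r: "r \<in> carrier R" and "x \<in> A <+>\<^bsub>M\<^esub> B"
  then obtain a b where *: "a \<in> A" "b \<in> B" "x = a \<oplus>\<^bsub>M\<^esub> b" by (auto simp: mem_set_add)
  then have "r \<odot>\<^bsub>M\<^esub> x = r \<odot>\<^bsub>M\<^esub> a \<oplus>\<^bsub>M\<^esub> r \<odot>\<^bsub>M\<^esub> b" by (simp add: sub r smult_r_distr)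
  with * r show "r \<odot>\<^bsub>M\<^esub> x \<in> A <+>\<^bsub>M\<^esub> B"
    using submoduleD(5)[OF A] submoduleD(5)[OF B] by (simp add: set_addI)
qed

lemma set_add_upper:
  assumes A: "submodule A R M" and B: "submodule B R M"
  shows "A \<subseteq> A <+>\<^bsub>M\<^esub> B" "B \<subseteq> A <+>\<^bsub>M\<^esub> B"
proof -
  have "x \<in> A <+>\<^bsub>M\<^esub> B" if "x \<in> A" for x
    using set_addI[OF that submoduleD(2)[OF B]] that submoduleD(1)[OF A] by auto
  then show "A \<subseteq> A <+>\<^bsub>M\<^esub> B" by blast
  have "x \<in> A <+>\<^bsub>M\<^esub> B" if "x \<in> B" for x
    using set_addI[OF submoduleD(2)[OF A] that] that submoduleD(1)[OF B] by auto
  then show "B \<subseteq> A <+>\<^bsub>M\<^esub> B" by blast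
qed

lemma restrict_left_module:
  assumes A: "submodule A R M"
  shows "left_module R (restrict_module M A)"
proof -
  note sub = subsetD[OF submoduleD(1)[OF A]]
  have "abelian_group (restrict_module M A)"
  proof (rule abelian_groupI)
    fix x assume "x \<in> carrier (restrict_module M A)"
    then show "\<exists>y\<in>carrier (restrict_module M A).
        y \<oplus>\<^bsub>restrict_module M A\<^esub> x = \<zero>\<^bsub>restrict_module M A\<^esub>"
      using submoduleD(4)[OF A] sub by (auto intro!: bexI[of _ "\<ominus>\<^bsub>M\<^esub> x"] simp: M.l_neg)
  qed (use submoduleD[OF A] sub in \<open>auto simp: M.a_ac\<close>)
  then show ?thesis
    using submoduleD(5)[OF A] sub
    by (intro left_module.intro left_module_axioms.intro R.ring_axioms)
      (auto simp: smult_l_distr smult_r_distr smult_assoc1)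
qed

text \<open>Through this, simplicity of a restricted module becomes a statement about the submodules
  of \<open>M\<close> below \<open>A\<close>.\<close>

lemma submodule_restrict_iff:
  assumes A: "submodule A R M"
  shows "submodule N R (restrict_module M A) \<longleftrightarrow> submodule N R M \<and> N \<subseteq> A"
proof
  interpret A: left_module R "restrict_module M A" by (rule restrict_left_module[OF A])
  {
    assume N: "submodule N R (restrict_module M A)"
    show "submodule N R M \<and> N \<subseteq> A"
      using A.submoduleD[OF N] submoduleD(1)[OF A] by (auto intro!: submodule_closedI)
  next
    assume "submodule N R M \<and> N \<subseteq> A"
    then show "submodule N R (restrict_module M A)"
      using submoduleD[of N] by (intro A.submodule_closedI) auto
  }
qed

section \<open>Submodules of quotients\<close>

lemma carrier_quot: "carrier (quot_module M K) = (\<lambda>x. K +>\<^bsub>M\<^esub> x) ` carrier M"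
  by (auto simp: quot_module_def A_RCOSETS_def')

lemma zero_quot:
  assumes "submodule K R M"
  shows "\<zero>\<^bsub>quot_module M K\<^esub> = K" "K +>\<^bsub>M\<^esub> \<zero>\<^bsub>M\<^esub> = K"
  using M.a_coset_add_zero[OF submoduleD(1)[OF assms]] by (simp_all add: quot_module_def)

lemma quot_add:
  assumes K: "submodule K R M" and "x \<in> carrier M" "y \<in> carrier M"
  shows "(K +>\<^bsub>M\<^esub> x) \<oplus>\<^bsub>quot_module M K\<^esub> (K +>\<^bsub>M\<^esub> y) = K +>\<^bsub>M\<^esub> (x \<oplus>\<^bsub>M\<^esub> y)"
proof -
  interpret A: abelian_subgroup K M by (rule submodule_abelian_subgroup[OF K])
  show ?thesis using A.a_rcos_sum assms by (simp add: quot_module_def)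
qed

text \<open>Since \<open>K \<subseteq> N\<close>, the set \<open>N\<close> is a union of cosets of
  \<open>K\<close>, and membership does not depend on the representative.\<close>

lemma coset_mem_image_iff:
  assumes K: "submodule K R M" and N: "submodule N R M" and KN: "K \<subseteq> N"
    and x: "x \<in> carrier M"
  shows "K +>\<^bsub>M\<^esub> x \<in> (\<lambda>x. K +>\<^bsub>M\<^esub> x) ` N \<longleftrightarrow> x \<in> N"
proof
  interpret A: abelian_subgroup K M by (rule submodule_abelian_subgroup[OF K])
  assume "K +>\<^bsub>M\<^esub> x \<in> (\<lambda>x. K +>\<^bsub>M\<^esub> x) ` N"
  then obtain y where y: "y \<in> N" "K +>\<^bsub>M\<^esub> x = K +>\<^bsub>M\<^esub> y" by auto
  with A.a_rcos_self[OF x] obtain k where "k \<in> K" "x = k \<oplus>\<^bsub>M\<^esub> y"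
    by (auto simp: a_r_coset_def')
  then show "x \<in> N" using y KN submoduleD(3)[OF N] by auto
qed auto

lemma image_quot_submodule:
  assumes K: "submodule K R M" and N: "submodule N R M"
  shows "submodule ((\<lambda>x. K +>\<^bsub>M\<^esub> x) ` N) R (quot_module M K)"
proof -
  interpret Q: left_module R "quot_module M K" by (rule quot_left_module[OF K])
  note sub = subsetD[OF submoduleD(1)[OF N]]
  show ?thesis
  proof (rule Q.submodule_closedI)
    show "(\<lambda>x. K +>\<^bsub>M\<^esub> x) ` N \<subseteq> carrier (quot_module M K)"
      using sub by (auto simp: carrier_quot)
    show "\<zero>\<^bsub>quot_module M K\<^esub> \<in> (\<lambda>x. K +>\<^bsub>M\<^esub> x) ` N"
      using zero_quot[OF K] submoduleD(2)[OF N] by force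
  qed (use sub submoduleD[OF N] quot_add[OF K] quot_smult[OF K] in auto)
qed

lemma preimage_quot_submodule:
  assumes K: "submodule K R M" and P: "submodule P R (quot_module M K)"
  shows "submodule {x \<in> carrier M. K +>\<^bsub>M\<^esub> x \<in> P} R M"
    and "K \<subseteq> {x \<in> carrier M. K +>\<^bsub>M\<^esub> x \<in> P}"
    and "(\<lambda>x. K +>\<^bsub>M\<^esub> x) ` {x \<in> carrier M. K +>\<^bsub>M\<^esub> x \<in> P} = P"
proof -
  interpret Q: left_module R "quot_module M K" by (rule quot_left_module[OF K])
  interpret A: abelian_subgroup K M by (rule submodule_abelian_subgroup[OF K])
  note P' = Q.submoduleD[OF P]
  show "submodule {x \<in> carrier M. K +>\<^bsub>M\<^esub> x \<in> P} R M"
    using P'(2) P'(3) P'(5) zero_quot[OF K]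
    by (intro submodule_closedI) (auto simp flip: quot_add[OF K] quot_smult[OF K])
  show "K \<subseteq> {x \<in> carrier M. K +>\<^bsub>M\<^esub> x \<in> P}"
    using P'(2) zero_quot[OF K] submoduleD(1)[OF K] A.a_rcos_const by auto
  show "(\<lambda>x. K +>\<^bsub>M\<^esub> x) ` {x \<in> carrier M. K +>\<^bsub>M\<^esub> x \<in> P} = P"
    using P'(1) by (auto simp: carrier_quot)
qed

text \<open>The projection reflects inclusions. This serves both the injectivity of the
  correspondence below and the comparison of a submodule with \<open>K\<close> and with
  \<open>carrier M\<close>.\<close>

lemma image_quot_subset_iff:
  assumes K: "submodule K R M" and N: "submodule N R M" and KN: "K \<subseteq> N"
    and N': "N' \<subseteq> carrier M"
  shows "(\<lambda>x. K +>\<^bsub>M\<^esub> x) ` N' \<subseteq> (\<lambda>x. K +>\<^bsub>M\<^esub> x) ` N \<longleftrightarrow> N' \<subseteq> N"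
  using coset_mem_image_iff[OF K N KN] N' by blast

text \<open>The correspondence theorem: injectivity is reflection of inclusions, and surjectivity
  takes preimages under the projection.\<close>

lemma bij_betw_submodules_quot:
  assumes K: "submodule K R M"
  shows "bij_betw (\<lambda>N. (\<lambda>x. K +>\<^bsub>M\<^esub> x) ` N) {N \<in> submodules R M. K \<subseteq> N}
    (submodules R (quot_module M K))"
proof (rule bij_betw_imageI)
  show "inj_on (\<lambda>N. (\<lambda>x. K +>\<^bsub>M\<^esub> x) ` N) {N \<in> submodules R M. K \<subseteq> N}"
  proof (rule inj_onI)
    fix N N' assume "N \<in> {N \<in> submodules R M. K \<subseteq> N}" "N' \<in> {N \<in> submodules R M. K \<subseteq> N}"
      and eq: "(\<lambda>x. K +>\<^bsub>M\<^esub> x) ` N = (\<lambda>x. K +>\<^bsub>M\<^esub> x) ` N'"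
    then have N: "submodule N R M" "K \<subseteq> N" and N': "submodule N' R M" "K \<subseteq> N'"
      by (auto simp: submodules_def)
    show "N = N'"
      using image_quot_subset_iff[OF K N submoduleD(1)[OF N'(1)]]
        image_quot_subset_iff[OF K N' submoduleD(1)[OF N(1)]] eq by simp
  qed
  show "(\<lambda>N. (\<lambda>x. K +>\<^bsub>M\<^esub> x) ` N) ` {N \<in> submodules R M. K \<subseteq> N}
      = submodules R (quot_module M K)"
  proof (intro equalityI subsetI)
    fix P assume "P \<in> submodules R (quot_module M K)"
    then have "submodule P R (quot_module M K)" by (simp add: submodules_def)
    from preimage_quot_submodule[OF K this]
    show "P \<in> (\<lambda>N. (\<lambda>x. K +>\<^bsub>M\<^esub> x) ` N) ` {N \<in> submodules R M. K \<subseteq> N}"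
      by (auto simp: submodules_def intro!: image_eqI[of P _ "{x \<in> carrier M. K +>\<^bsub>M\<^esub> x \<in> P}"])
  qed (auto simp: submodules_def image_quot_submodule[OF K])
qed

text \<open>The image of \<open>X\<close> must be zero or everything, and reflection of inclusions
  carries both cases back to \<open>M\<close>.\<close>

lemma simple_quot_intermediate:
  assumes K: "submodule K R M" and simple: "simple_module R (quot_module M K)"
    and X: "submodule X R M" "K \<subseteq> X"
  shows "X = K \<or> X = carrier M"
proof -
  have "(\<lambda>x. K +>\<^bsub>M\<^esub> x) ` X \<in> submodules R (quot_module M K)"
    using image_quot_submodule[OF K X(1)] by (simp add: submodules_def)
  with simple have "(\<lambda>x. K +>\<^bsub>M\<^esub> x) ` X = {\<zero>\<^bsub>quot_module M K\<^esub>} \<or>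
      (\<lambda>x. K +>\<^bsub>M\<^esub> x) ` X = carrier (quot_module M K)"
    by (auto simp: simple_module_def)
  then show ?thesis
  proof
    assume "(\<lambda>x. K +>\<^bsub>M\<^esub> x) ` X = {\<zero>\<^bsub>quot_module M K\<^esub>}"
    moreover have "\<zero>\<^bsub>quot_module M K\<^esub> \<in> (\<lambda>x. K +>\<^bsub>M\<^esub> x) ` K"
      using zero_quot[OF K] submoduleD(2)[OF K] by force
    ultimately have "(\<lambda>x. K +>\<^bsub>M\<^esub> x) ` X \<subseteq> (\<lambda>x. K +>\<^bsub>M\<^esub> x) ` K" by simp
    then have "X \<subseteq> K"
      using image_quot_subset_iff[OF K K order_refl submoduleD(1)[OF X(1)]] by simp
    with X show ?thesis by auto
  next
    assume "(\<lambda>x. K +>\<^bsub>M\<^esub> x) ` X = carrier (quot_module M K)"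
    then have "carrier M \<subseteq> X"
      using image_quot_subset_iff[OF K X order_refl] by (simp add: carrier_quot)
    with submoduleD(1)[OF X(1)] show ?thesis by auto
  qed
qed

end

section \<open>Finite length\<close>

text \<open>
  A rank function bounded by \<open>n\<close> replaces both chain conditions. If \<open>N \<subseteq> N'\<close> meet the same factors
  of the series nontrivially, then \<open>N' \<inter> F i \<subseteq> N\<close> follows by induction on \<open>i\<close>.
\<close>

lemma (in left_module) composition_series_rank:
  assumes cs: "composition_series R M n F"
  defines "rk \<equiv> \<lambda>N. card {i. i < n \<and> \<not> N \<inter> F (Suc i) \<subseteq> F i}"
  assumes N: "submodule N R M" and N': "submodule N' R M" and less: "N \<subset> N'"
  shows "rk N < rk N'"
proof (rule ccontr)
  assume not_less: "\<not> rk N < rk N'"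
  let ?I = "\<lambda>N. {i. i < n \<and> \<not> N \<inter> F (Suc i) \<subseteq> F i}"
  have F: "submodule (F i) R M" if "i \<le> n" for i
    using cs that by (auto simp: composition_series_def submodules_def)
  have F_mono: "F i \<subseteq> F (Suc i)" if "i < n" for i
    using cs that by (auto simp: composition_series_def)
  have "?I N \<subseteq> ?I N'" using less by auto
  \<comment> \<open>One index set contains the other, so without a strict increase in cardinality
    these finite sets coincide.\<close>
  then have I_eq: "?I N = ?I N'"
    using not_less card_mono[of "?I N'" "?I N"] by (intro card_subset_eq) (simp_all add: rk_def)
  have "N' \<inter> F i \<subseteq> N" if "i \<le> n" for i
    using that
  proof (induction i)
    case 0
    then show ?case using cs submoduleD(2)[OF N] by (auto simp: composition_series_def)
  next
    case (Suc i)
    then have i: "i < n" and IH: "N' \<inter> F i \<subseteq> N" by auto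
    note Fi = F[OF less_imp_le[OF i]] and FS = F[OF Suc_leI[OF i]]
    show ?case
    proof (cases "i \<in> ?I N")
      case True
      \<comment> \<open>By simplicity of the factor, \<open>?X\<close> is \<open>F i\<close> or
        \<open>F (Suc i)\<close>. The first is impossible because \<open>N\<close> meets
        \<open>F (Suc i)\<close> outside \<open>F i\<close>.\<close>
      let ?X = "F i <+>\<^bsub>M\<^esub> (N \<inter> F (Suc i))"
      note NF = submodule_Int[OF N FS]
      have X: "submodule ?X R M" by (rule submodule_set_add[OF Fi NF])
      have "?X \<subseteq> F (Suc i)"
        using F_mono[OF i] by (auto simp: mem_set_add intro!: submoduleD(3)[OF FS])
      interpret A: left_module R "restrict_module M (F (Suc i))"
        by (rule restrict_left_module[OF FS])
      have "simple_module R (quot_module (restrict_module M (F (Suc i))) (F i))"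
        using cs i by (auto simp: composition_series_def)
      then have "?X = F i \<or> ?X = carrier (restrict_module M (F (Suc i)))"
        using Fi X \<open>?X \<subseteq> F (Suc i)\<close> F_mono[OF i] set_add_upper(1)[OF Fi NF]
        by (intro A.simple_quot_intermediate) (auto simp: submodule_restrict_iff[OF FS])
      moreover have "?X \<noteq> F i" using True set_add_upper(2)[OF Fi NF] by auto
      ultimately have X_eq: "?X = F (Suc i)" by simp
      show ?thesis
      proof
        fix x assume x: "x \<in> N' \<inter> F (Suc i)"
        then have "x \<in> ?X" using X_eq by simp
        \<comment> \<open>As \<open>y\<close> lies in \<open>N \<subseteq> N'\<close>, the
          difference \<open>z\<close> of \<open>x\<close> and \<open>y\<close> lies in
          \<open>N' \<inter> F i\<close>, where the induction hypothesis applies.\<close>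
        then obtain z y where zy: "z \<in> F i" "y \<in> N" "x = z \<oplus>\<^bsub>M\<^esub> y"
          by (auto simp: mem_set_add)
        have c: "z \<in> carrier M" "y \<in> carrier M"
          using zy submoduleD(1)[OF Fi] submoduleD(1)[OF N] by auto
        have "z \<in> N'"
          using submodule_add_cancel[OF N', of y z] x zy less c by (auto simp: M.a_comm)
        then have "z \<in> N" using IH zy by auto
        then show "x \<in> N" using zy submoduleD(3)[OF N] by auto
      qed
    next
      case False
      \<comment> \<open>A factor missed by \<open>N\<close> is also missed by \<open>N'\<close>,
        since the index sets agree.\<close>
      then have "N' \<inter> F (Suc i) \<subseteq> F i" using I_eq i by auto
      then show ?thesis using IH by auto
    qed
  qed
  from this[of n] have "N' \<inter> carrier M \<subseteq> N" using cs by (auto simp: composition_series_def)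
  then show False using less submoduleD(1)[OF N'] by auto
qed

section \<open>Homomorphisms\<close>

lemma module_homD:
  assumes "h \<in> module_hom R M N"
  shows "\<And>x. x \<in> carrier M \<Longrightarrow> h x \<in> carrier N"
    and "\<And>x y. x \<in> carrier M \<Longrightarrow> y \<in> carrier M \<Longrightarrow> h (x \<oplus>\<^bsub>M\<^esub> y) = h x \<oplus>\<^bsub>N\<^esub> h y"
    and "\<And>a x. a \<in> carrier R \<Longrightarrow> x \<in> carrier M \<Longrightarrow> h (a \<odot>\<^bsub>M\<^esub> x) = a \<odot>\<^bsub>N\<^esub> h x"
  using assms by (auto simp: module_hom_def)

lemma module_homI:
  assumes "\<And>x. x \<in> carrier M \<Longrightarrow> h x \<in> carrier N"
    and "\<And>x y. x \<in> carrier M \<Longrightarrow> y \<in> carrier M \<Longrightarrow> h (x \<oplus>\<^bsub>M\<^esub> y) = h x \<oplus>\<^bsub>N\<^esub> h y"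
    and "\<And>a x. a \<in> carrier R \<Longrightarrow> x \<in> carrier M \<Longrightarrow> h (a \<odot>\<^bsub>M\<^esub> x) = a \<odot>\<^bsub>N\<^esub> h x"
  shows "h \<in> module_hom R M N"
  using assms by (auto simp: module_hom_def)

context left_module
begin

lemma module_hom_zero:
  assumes "left_module R N" "h \<in> module_hom R M N"
  shows "h \<zero>\<^bsub>M\<^esub> = \<zero>\<^bsub>N\<^esub>"
proof -
  interpret N: left_module R N by fact
  have "h \<zero>\<^bsub>M\<^esub> \<oplus>\<^bsub>N\<^esub> h \<zero>\<^bsub>M\<^esub> = h \<zero>\<^bsub>M\<^esub>"
    using module_homD(2)[OF assms(2) M.zero_closed M.zero_closed] by simp
  then show ?thesis using N.M.add.l_cancel_one module_homD(1)[OF assms(2)] by simp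
qed

lemma module_hom_inj_on:
  assumes "left_module R N" "h \<in> module_hom R M N"
    and ker: "\<And>x. x \<in> carrier M \<Longrightarrow> h x = \<zero>\<^bsub>N\<^esub> \<Longrightarrow> x = \<zero>\<^bsub>M\<^esub>"
  shows "inj_on h (carrier M)"
proof (rule inj_onI)
  interpret N: left_module R N by fact
  note h = module_homD[OF assms(2)]
  fix x y assume xy: "x \<in> carrier M" "y \<in> carrier M" "h x = h y"
  have "h (x \<oplus>\<^bsub>M\<^esub> \<ominus>\<^bsub>M\<^esub> y) = h (y \<oplus>\<^bsub>M\<^esub> \<ominus>\<^bsub>M\<^esub> y)" using xy by (simp add: h)
  also have "\<dots> = \<zero>\<^bsub>N\<^esub>" using xy by (simp add: M.r_neg module_hom_zero[OF assms(1,2)])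
  finally have "x \<oplus>\<^bsub>M\<^esub> \<ominus>\<^bsub>M\<^esub> y = \<zero>\<^bsub>M\<^esub>" using ker xy by simp
  then show "x = y" using xy M.minus_equality[of x "\<ominus>\<^bsub>M\<^esub> y"] by simp
qed

lemma module_iso_inv_into:
  assumes "h \<in> module_iso R M N"
  shows "inv_into (carrier M) h \<in> module_iso R N M"
proof -
  have h: "h \<in> module_hom R M N" and b: "bij_betw h (carrier M) (carrier N)"
    using assms by (auto simp: module_iso_def)
  note h' = module_homD[OF h]
  let ?g = "inv_into (carrier M) h"
  have bg: "bij_betw ?g (carrier N) (carrier M)" by (rule bij_betw_inv_into[OF b])
  have gc: "?g y \<in> carrier M" if "y \<in> carrier N" for y using bg that by (rule bij_betw_apply)
  have hg: "h (?g y) = y" if "y \<in> carrier N" for y using b that by (rule bij_betw_inv_into_right)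
  have gh: "?g (h x) = x" if "x \<in> carrier M" for x using b that by (rule bij_betw_inv_into_left)
  have "?g \<in> module_hom R N M"
  proof (rule module_homI)
    fix x y assume xy: "x \<in> carrier N" "y \<in> carrier N"
    have "?g (x \<oplus>\<^bsub>N\<^esub> y) = ?g (h (?g x \<oplus>\<^bsub>M\<^esub> ?g y))" using xy by (simp add: h' gc hg)
    also have "\<dots> = ?g x \<oplus>\<^bsub>M\<^esub> ?g y" using xy by (intro gh) (simp add: gc)
    finally show "?g (x \<oplus>\<^bsub>N\<^esub> y) = ?g x \<oplus>\<^bsub>M\<^esub> ?g y" .
  next
    fix a x assume ax: "a \<in> carrier R" "x \<in> carrier N"
    have "?g (a \<odot>\<^bsub>N\<^esub> x) = ?g (h (a \<odot>\<^bsub>M\<^esub> ?g x))" using ax by (simp add: h' gc hg)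
    also have "\<dots> = a \<odot>\<^bsub>M\<^esub> ?g x" using ax by (intro gh) (simp add: gc)
    finally show "?g (a \<odot>\<^bsub>N\<^esub> x) = a \<odot>\<^bsub>M\<^esub> ?g x" .
  qed (simp add: gc)
  with bg show ?thesis by (simp add: module_iso_def)
qed

text \<open>One nonzero value makes the kernel proper and the image nonzero. Simplicity of
  \<open>M\<close> then kills the kernel, and simplicity of \<open>N\<close> makes the image
  everything.\<close>

lemma schur:
  assumes simpleM: "simple_module R M" and simpleN: "simple_module R N"
    and h: "h \<in> module_hom R M N" and x: "x \<in> carrier M" "h x \<noteq> \<zero>\<^bsub>N\<^esub>"
  shows "h \<in> module_iso R M N"
proof -
  have lmN: "left_module R N" using simpleN by (simp add: simple_module_def)
  interpret N: left_module R N by fact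
  note h' = module_homD[OF h] and h0 = module_hom_zero[OF lmN h]
  let ?ker = "{x \<in> carrier M. h x = \<zero>\<^bsub>N\<^esub>}"
  have "submodule ?ker R M" by (rule submodule_closedI) (auto simp: h' h0)
  with simpleM x have "?ker = {\<zero>\<^bsub>M\<^esub>}" by (auto simp: simple_module_def submodules_def)
  then have inj: "inj_on h (carrier M)" by (intro module_hom_inj_on[OF lmN h]) auto
  have "submodule (h ` carrier M) R N"
  proof (rule N.submodule_closedI)
    show "\<zero>\<^bsub>N\<^esub> \<in> h ` carrier M" by (metis h0 M.zero_closed image_eqI)
  qed (auto simp: h' simp flip: h'(2,3))
  with simpleN have "h ` carrier M = {\<zero>\<^bsub>N\<^esub>} \<or> h ` carrier M = carrier N"
    by (auto simp: simple_module_def submodules_def)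
  with x have "h ` carrier M = carrier N" by blast
  with inj h show ?thesis by (simp add: module_iso_def bij_betw_def)
qed

section \<open>Complements and graphs\<close>

lemma simple_restrictI:
  assumes A: "submodule A R M" "A \<noteq> {\<zero>\<^bsub>M\<^esub>}"
    and min: "\<And>N. submodule N R M \<Longrightarrow> N \<subseteq> A \<Longrightarrow> N = {\<zero>\<^bsub>M\<^esub>} \<or> N = A"
  shows "simple_module R (restrict_module M A)"
  using assms by (auto simp: simple_module_def submodules_def submodule_restrict_iff
      restrict_left_module)

text \<open>The difference of \<open>a'\<close> and \<open>a\<close> is also the difference of
  \<open>b \<oplus> a'\<close> and \<open>b \<oplus> a\<close>, so it lies in
  \<open>A \<inter> B\<close>. This makes the graph map below single-valued.\<close>

lemma direct_sum_unique:
  assumes A: "submodule A R M" and B: "submodule B R M" and AB: "A \<inter> B = {\<zero>\<^bsub>M\<^esub>}"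
    and "a \<in> A" "a' \<in> A" "b \<in> carrier M" "b \<oplus>\<^bsub>M\<^esub> a \<in> B" "b \<oplus>\<^bsub>M\<^esub> a' \<in> B"
  shows "a = a'"
proof -
  have c: "a \<in> carrier M" "a' \<in> carrier M" using assms submoduleD(1)[OF A] by auto
  have "(b \<oplus>\<^bsub>M\<^esub> a) \<oplus>\<^bsub>M\<^esub> (a' \<oplus>\<^bsub>M\<^esub> \<ominus>\<^bsub>M\<^esub> a) = (b \<oplus>\<^bsub>M\<^esub> a') \<oplus>\<^bsub>M\<^esub> (a \<oplus>\<^bsub>M\<^esub> \<ominus>\<^bsub>M\<^esub> a)"
    using c assms(6) by (simp add: M.a_ac del: M.r_neg)
  also have "\<dots> = b \<oplus>\<^bsub>M\<^esub> a'" using c assms(6) by (simp add: M.r_neg)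
  finally have "(b \<oplus>\<^bsub>M\<^esub> a) \<oplus>\<^bsub>M\<^esub> (a' \<oplus>\<^bsub>M\<^esub> \<ominus>\<^bsub>M\<^esub> a) \<in> B" using assms by simp
  then have "a' \<oplus>\<^bsub>M\<^esub> \<ominus>\<^bsub>M\<^esub> a \<in> B"
    using submodule_add_cancel[OF B assms(7)] c by simp
  moreover have "a' \<oplus>\<^bsub>M\<^esub> \<ominus>\<^bsub>M\<^esub> a \<in> A"
    using assms submoduleD(3,4)[OF A] by auto
  ultimately have "a' \<oplus>\<^bsub>M\<^esub> \<ominus>\<^bsub>M\<^esub> a = \<zero>\<^bsub>M\<^esub>" using AB by auto
  then show ?thesis using c M.minus_equality[of a' "\<ominus>\<^bsub>M\<^esub> a"] by simp
qed

text \<open>Equality of the sums gives each \<open>b\<close> some \<open>a \<in> A\<close> with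
  \<open>b \<oplus> a \<in> B'\<close>, and the trivial intersection makes it unique. Uniqueness
  then yields linearity, because sums and multiples of such \<open>a\<close> satisfy the condition
  for the corresponding \<open>b\<close>.\<close>

lemma complement_graph:
  assumes A: "submodule A R M" and B: "submodule B R M" and B': "submodule B' R M"
    and sum: "A <+>\<^bsub>M\<^esub> B' = A <+>\<^bsub>M\<^esub> B" and disj: "A \<inter> B' = {\<zero>\<^bsub>M\<^esub>}"
  shows "\<exists>f \<in> module_hom R (restrict_module M B) (restrict_module M A) \<inter> extensional B.
    B' = {b \<oplus>\<^bsub>M\<^esub> f b | b. b \<in> B}"
proof -
  note Ac = subsetD[OF submoduleD(1)[OF A]] and Bc = subsetD[OF submoduleD(1)[OF B]]
    and B'c = subsetD[OF submoduleD(1)[OF B']]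
  have ex: "\<exists>a\<in>A. b \<oplus>\<^bsub>M\<^esub> a \<in> B'" if b: "b \<in> B" for b
  proof -
    have "b \<in> A <+>\<^bsub>M\<^esub> B'" using set_add_upper(2)[OF A B] b sum by auto
    then obtain a b' where ab: "a \<in> A" "b' \<in> B'" "b = a \<oplus>\<^bsub>M\<^esub> b'" by (auto simp: mem_set_add)
    \<comment> \<open>The required element of \<open>A\<close> is the negative of the
      \<open>A\<close>-component of \<open>b\<close>.\<close>
    have "b \<oplus>\<^bsub>M\<^esub> \<ominus>\<^bsub>M\<^esub> a = b'" using ab Ac[of a] B'c[of b'] by (simp add: M.a_assoc M.a_comm[of b'] M.r_neg2)
    then show ?thesis using ab submoduleD(4)[OF A] by (intro bexI[of _ "\<ominus>\<^bsub>M\<^esub> a"]) auto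
  qed
  \<comment> \<open>Restricting to \<open>B\<close> makes \<open>f\<close> extensional, so that
    different maps really differ on \<open>B\<close> when they are counted later.\<close>
  define f where "f = (\<lambda>b\<in>B. SOME a. a \<in> A \<and> b \<oplus>\<^bsub>M\<^esub> a \<in> B')"
  have f: "f b \<in> A" "b \<oplus>\<^bsub>M\<^esub> f b \<in> B'" if "b \<in> B" for b
    using someI_ex[of "\<lambda>a. a \<in> A \<and> b \<oplus>\<^bsub>M\<^esub> a \<in> B'"] ex that by (auto simp: f_def)
  have f_eq: "f b = a" if "b \<in> B" "a \<in> A" "b \<oplus>\<^bsub>M\<^esub> a \<in> B'" for a b
    using direct_sum_unique[OF A B' disj] f that Bc by blast
  have hom: "f \<in> module_hom R (restrict_module M B) (restrict_module M A)"
  proof (rule module_homI)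
    fix x y assume "x \<in> carrier (restrict_module M B)" "y \<in> carrier (restrict_module M B)"
    then have xy: "x \<in> B" "y \<in> B" by auto
    have c: "x \<in> carrier M" "y \<in> carrier M" "f x \<in> carrier M" "f y \<in> carrier M"
      using xy Bc f(1) Ac by auto
    have "(x \<oplus>\<^bsub>M\<^esub> y) \<oplus>\<^bsub>M\<^esub> (f x \<oplus>\<^bsub>M\<^esub> f y) = (x \<oplus>\<^bsub>M\<^esub> f x) \<oplus>\<^bsub>M\<^esub> (y \<oplus>\<^bsub>M\<^esub> f y)"
      using c by (simp add: M.a_ac)
    then have "f (x \<oplus>\<^bsub>M\<^esub> y) = f x \<oplus>\<^bsub>M\<^esub> f y"
      using xy f submoduleD(3)[OF A] submoduleD(3)[OF B] submoduleD(3)[OF B']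
      by (intro f_eq) auto
    then show "f (x \<oplus>\<^bsub>restrict_module M B\<^esub> y) = f x \<oplus>\<^bsub>restrict_module M A\<^esub> f y" by simp
  next
    fix r x assume r: "r \<in> carrier R" and "x \<in> carrier (restrict_module M B)"
    then have x: "x \<in> B" by auto
    have "r \<odot>\<^bsub>M\<^esub> x \<oplus>\<^bsub>M\<^esub> r \<odot>\<^bsub>M\<^esub> f x = r \<odot>\<^bsub>M\<^esub> (x \<oplus>\<^bsub>M\<^esub> f x)"
      using r x Bc Ac[OF f(1)[OF x]] by (simp add: smult_r_distr)
    then have "f (r \<odot>\<^bsub>M\<^esub> x) = r \<odot>\<^bsub>M\<^esub> f x"
      using r x f submoduleD(5)[OF A] submoduleD(5)[OF B] submoduleD(5)[OF B']
      by (intro f_eq) auto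
    then show "f (r \<odot>\<^bsub>restrict_module M B\<^esub> x) = r \<odot>\<^bsub>restrict_module M A\<^esub> f x" by simp
  qed (simp add: f)
  have "B' = {b \<oplus>\<^bsub>M\<^esub> f b | b. b \<in> B}"
  proof (intro equalityI subsetI)
    fix x assume x: "x \<in> B'"
    then have "x \<in> A <+>\<^bsub>M\<^esub> B" using set_add_upper(2)[OF A B'] sum by auto
    then obtain a b where ab: "a \<in> A" "b \<in> B" "x = b \<oplus>\<^bsub>M\<^esub> a"
      using Ac Bc by (auto simp: mem_set_add M.a_comm)
    then show "x \<in> {b \<oplus>\<^bsub>M\<^esub> f b | b. b \<in> B}" using f_eq x by blast
  qed (use f in auto)
  moreover have "f \<in> extensional B" by (simp add: f_def)
  ultimately show ?thesis using hom by blast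
qed

text \<open>The natural map goes from pairs to the sum: embed the second copy of \<open>A\<close>
  through \<open>h\<close> and add. It is inverted only at the end.\<close>

lemma direct_sum_iso:
  assumes A: "submodule A R M" and B: "submodule B R M" and disj: "A \<inter> B = {\<zero>\<^bsub>M\<^esub>}"
    and h: "h \<in> module_iso R (restrict_module M A) (restrict_module M B)"
  shows "isomorphic_modules R (restrict_module M (A <+>\<^bsub>M\<^esub> B))
    (dsum_module (restrict_module M A) (restrict_module M A))"
proof -
  note Ac = subsetD[OF submoduleD(1)[OF A]] and Bc = subsetD[OF submoduleD(1)[OF B]]
  let ?S = "restrict_module M A" and ?L = "restrict_module M (A <+>\<^bsub>M\<^esub> B)"
  interpret S: left_module R ?S by (rule restrict_left_module[OF A])
  interpret D: left_module R "dsum_module ?S ?S"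
    by (rule S.dsum_left_module[OF restrict_left_module[OF A]])
  have L: "left_module R ?L" by (rule restrict_left_module[OF submodule_set_add[OF A B]])
  have lmB: "left_module R (restrict_module M B)" by (rule restrict_left_module[OF B])
  have hh: "h \<in> module_hom R ?S (restrict_module M B)" and bij: "bij_betw h A B"
    using h by (auto simp: module_iso_def)
  note h' = module_homD[OF hh, simplified]
  have h0: "h \<zero>\<^bsub>M\<^esub> = \<zero>\<^bsub>M\<^esub>" using S.module_hom_zero[OF lmB hh] by simp
  let ?g = "\<lambda>(x, y). x \<oplus>\<^bsub>M\<^esub> h y"
  have g: "?g \<in> module_hom R (dsum_module ?S ?S) ?L"
    by (rule module_homI)
      (auto simp: dsum_module_def set_addI h' Ac Bc smult_r_distr M.a_ac)
  have "inj_on ?g (carrier (dsum_module ?S ?S))"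
  proof (rule D.module_hom_inj_on[OF L g])
    fix p assume "p \<in> carrier (dsum_module ?S ?S)" "?g p = \<zero>\<^bsub>?L\<^esub>"
    then obtain x y where p: "p = (x, y)" "x \<in> A" "y \<in> A" "x \<oplus>\<^bsub>M\<^esub> h y = \<zero>\<^bsub>M\<^esub>"
      by (auto simp: dsum_module_def)
    note c = Ac[OF p(2)] Bc[OF h'(1)[OF p(3)]]
    \<comment> \<open>Both \<open>x\<close> and \<open>x \<oplus> h y = \<zero>\<close> lie in
      \<open>A\<close>, so \<open>h y\<close> falls into the trivial intersection.\<close>
    have "h y \<in> A"
      using submodule_add_cancel[OF A p(2) c(2)] p(4) submoduleD(2)[OF A] by simp
    then have hy: "h y = \<zero>\<^bsub>M\<^esub>" using disj h'(1)[OF p(3)] by auto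
    then have "y = \<zero>\<^bsub>M\<^esub>"
      using inj_onD[OF bij_betw_imp_inj_on[OF bij], of y "\<zero>\<^bsub>M\<^esub>"] p(3) submoduleD(2)[OF A] h0
      by simp
    moreover have "x = \<zero>\<^bsub>M\<^esub>" using p(4) hy c by simp
    ultimately show "p = \<zero>\<^bsub>dsum_module ?S ?S\<^esub>" using p(1) by (simp add: dsum_module_def)
  qed
  moreover have "?g ` carrier (dsum_module ?S ?S) = carrier ?L"
  proof (intro equalityI subsetI)
    fix z assume "z \<in> carrier ?L"
    then obtain x b where xb: "x \<in> A" "b \<in> B" "z = x \<oplus>\<^bsub>M\<^esub> b" by (auto simp: mem_set_add)
    then obtain y where "y \<in> A" "b = h y" using bij by (auto simp: bij_betw_def)
    with xb show "z \<in> ?g ` carrier (dsum_module ?S ?S)"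
      by (auto simp: dsum_module_def intro!: image_eqI[of _ _ "(x, y)"])
  qed (use module_homD(1)[OF g] in auto)
  ultimately have "?g \<in> module_iso R (dsum_module ?S ?S) ?L"
    using g by (simp add: module_iso_def bij_betw_def)
  from D.module_iso_inv_into[OF this] show ?thesis by (auto simp: isomorphic_modules_def)
qed

text \<open>Fixing one complement \<open>B\<close> turns the others into graphs of homomorphisms
  from \<open>B\<close> to \<open>A\<close>. A nonzero one among these is an isomorphism, which
  identifies \<open>B\<close> with \<open>A\<close> and carries the infinitely many homomorphisms
  into the endomorphism ring of \<open>A\<close>.\<close>

lemma infinite_complements:
  assumes A: "submodule A R M" and simA: "simple_module R (restrict_module M A)"
    and inf: "infinite {B \<in> submodules R M. simple_module R (restrict_module M B) \<and>
      A \<inter> B = {\<zero>\<^bsub>M\<^esub>} \<and> A <+>\<^bsub>M\<^esub> B = C}" (is "infinite ?\<B>")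
  shows "isomorphic_modules R (restrict_module M C)
      (dsum_module (restrict_module M A) (restrict_module M A))"
    and "infinite (carrier (End_ring R (restrict_module M A)))"
proof -
  obtain B where "B \<in> ?\<B>" using infinite_imp_nonempty[OF inf] by blast
  then have B: "submodule B R M" and simB: "simple_module R (restrict_module M B)"
    and disj: "A \<inter> B = {\<zero>\<^bsub>M\<^esub>}" and C: "A <+>\<^bsub>M\<^esub> B = C"
    by (auto simp: submodules_def)
  let ?SA = "restrict_module M A" and ?SB = "restrict_module M B"
  interpret SA: left_module R ?SA by (rule restrict_left_module[OF A])
  interpret SB: left_module R ?SB by (rule restrict_left_module[OF B])
  let ?H = "module_hom R ?SB ?SA \<inter> extensional B"
  \<comment> \<open>A complement is determined by its map, so infinitely many complements require
    infinitely many maps.\<close>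
  have "?\<B> \<subseteq> (\<lambda>f. {b \<oplus>\<^bsub>M\<^esub> f b | b. b \<in> B}) ` ?H"
    using complement_graph[OF A B] C by (auto simp: submodules_def image_iff)
  then have infH: "infinite ?H" using inf by (meson finite_imageI finite_subset)
  \<comment> \<open>An infinite set of maps cannot consist of the zero map alone. Schur's lemma
    needs only one nonzero value.\<close>
  then have "\<not> ?H \<subseteq> {\<lambda>b\<in>B. \<zero>\<^bsub>M\<^esub>}" using finite_subset by blast
  then obtain f where f: "f \<in> ?H" "f \<noteq> (\<lambda>b\<in>B. \<zero>\<^bsub>M\<^esub>)" by blast
  then obtain b where b: "b \<in> B" "f b \<noteq> \<zero>\<^bsub>M\<^esub>"
    by (metis (no_types, lifting) IntD2 extensionalityI restrict_apply' restrict_extensional)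
  have "f \<in> module_iso R ?SB ?SA" using f b by (intro SB.schur[OF simB simA, of _ b]) auto
  from SB.module_iso_inv_into[OF this] obtain h where h: "h \<in> module_iso R ?SA ?SB" by blast
  show "isomorphic_modules R (restrict_module M C) (dsum_module ?SA ?SA)"
    using direct_sum_iso[OF A B disj h] C by simp
  have hh: "h \<in> module_hom R ?SA ?SB" and him: "h ` A = B"
    using h by (auto simp: module_iso_def bij_betw_def)
  note h' = module_homD[OF hh, simplified]
  \<comment> \<open>Precomposition with \<open>h\<close> loses nothing: \<open>h\<close> maps onto
    \<open>B\<close>, and off \<open>B\<close> the maps agree by extensionality.\<close>
  have "inj_on (\<lambda>g. \<lambda>x\<in>A. g (h x)) ?H"
  proof (rule inj_onI)
    fix g g' assume g: "g \<in> ?H" "g' \<in> ?H" and eq: "(\<lambda>x\<in>A. g (h x)) = (\<lambda>x\<in>A. g' (h x))"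
    have "g y = g' y" if y: "y \<in> B" for y
    proof -
      obtain x where "x \<in> A" "y = h x" using y him by blast
      then show ?thesis using fun_cong[OF eq, of x] by simp
    qed
    then show "g = g'" using g by (auto intro: extensionalityI)
  qed
  then have "infinite ((\<lambda>g. \<lambda>x\<in>A. g (h x)) ` ?H)" using infH by (simp add: finite_image_iff)
  moreover have "(\<lambda>g. \<lambda>x\<in>A. g (h x)) ` ?H \<subseteq> carrier (End_ring R ?SA)"
  proof (rule image_subsetI)
    fix g assume "g \<in> ?H"
    then have "g \<in> module_hom R ?SB ?SA" by simp
    note g' = module_homD[OF this, simplified]
    have "(\<lambda>x\<in>carrier ?SA. g (h x)) \<in> carrier (End_ring R ?SA)"
      by (rule SA.End_ring_memI) (simp_all add: g' h')
    then show "(\<lambda>x\<in>A. g (h x)) \<in> carrier (End_ring R ?SA)" by simp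
  qed
  ultimately show "infinite (carrier (End_ring R ?SA))" using finite_subset by blast
qed

text \<open>This is the case to which a maximal choice of \<open>K\<close> reduces the theorem. The
  rank is kept abstract because on a quotient it will be the rank of the preimage; here it only
  supplies minimal submodules.\<close>

lemma infinite_submodules_critical:
  fixes rk :: "'b set \<Rightarrow> nat"
  assumes rk: "\<And>N N'. submodule N R M \<Longrightarrow> submodule N' R M \<Longrightarrow> N \<subset> N' \<Longrightarrow> rk N < rk N'"
    and inf: "infinite (submodules R M)"
    and fin: "\<And>P. submodule P R M \<Longrightarrow> P \<noteq> {\<zero>\<^bsub>M\<^esub>} \<Longrightarrow> finite {N \<in> submodules R M. P \<subseteq> N}"
  shows "\<exists>A C. submodule A R M \<and> submodule C R M \<and> simple_module R (restrict_module M A) \<and>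
    isomorphic_modules R (restrict_module M C)
      (dsum_module (restrict_module M A) (restrict_module M A)) \<and>
    infinite (carrier (End_ring R (restrict_module M A)))"
proof -
  define \<A> where "\<A> = {A \<in> submodules R M. simple_module R (restrict_module M A)}"
  have zero_le: "\<zero>\<^bsub>M\<^esub> \<in> N" if "N \<in> submodules R M" for N
    using submoduleD(2) that by (auto simp: submodules_def)
  have ex_min: "\<exists>A\<in>\<A>. A \<subseteq> P" if P: "submodule P R M" "P \<noteq> {\<zero>\<^bsub>M\<^esub>}" for P
  proof -
    \<comment> \<open>A nonzero submodule of least rank below \<open>P\<close> is simple, since a
      smaller nonzero one would have smaller rank.\<close>
    define Q where "Q N \<longleftrightarrow> submodule N R M \<and> N \<noteq> {\<zero>\<^bsub>M\<^esub>} \<and> N \<subseteq> P" for N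
    have "Q P" using P by (simp add: Q_def)
    then obtain A where A: "Q A" "\<And>N. Q N \<Longrightarrow> rk A \<le> rk N"
      using ex_has_least_nat[of Q P rk] by blast
    have "simple_module R (restrict_module M A)"
    proof (rule simple_restrictI)
      fix N assume N: "submodule N R M" "N \<subseteq> A"
      then show "N = {\<zero>\<^bsub>M\<^esub>} \<or> N = A"
        using A rk[of N A] by (fastforce simp: Q_def)
    qed (use A in \<open>auto simp: Q_def\<close>)
    then show ?thesis using A by (auto simp: \<A>_def submodules_def Q_def)
  qed
  \<comment> \<open>Every nonzero submodule lies above a simple one. With finitely many simple
    submodules, this union of finite sets would be finite.\<close>
  have "submodules R M \<subseteq> {{\<zero>\<^bsub>M\<^esub>}} \<union> (\<Union>A\<in>\<A>. {N \<in> submodules R M. A \<subseteq> N})"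
    using ex_min by (auto simp: submodules_def)
  moreover have fin\<A>: "finite {N \<in> submodules R M. A \<subseteq> N}" if "A \<in> \<A>" for A
    using that by (intro fin) (auto simp: \<A>_def submodules_def simple_module_def)
  ultimately have inf\<A>: "infinite \<A>"
    using inf by (meson finite.emptyI finite.insertI finite_UN_I finite_Un finite_subset)
  then obtain A where A: "A \<in> \<A>" using infinite_imp_nonempty by blast
  then have subA: "submodule A R M" and simA: "simple_module R (restrict_module M A)"
    by (auto simp: \<A>_def submodules_def)
  have "infinite (\<A> - {A})" using inf\<A> by simp
  \<comment> \<open>All these sums contain \<open>A\<close>, and only finitely many submodules do.
    The pigeonhole principle then gives one sum that occurs infinitely often.\<close>
  moreover have "finite ((\<lambda>B. A <+>\<^bsub>M\<^esub> B) ` (\<A> - {A}))"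
    by (rule finite_subset[OF _ fin\<A>[OF A]])
      (auto simp: \<A>_def submodules_def submodule_set_add[OF subA] set_add_upper[OF subA, THEN subsetD])
  ultimately obtain B0 where B0: "B0 \<in> \<A> - {A}"
    and infB: "infinite {B \<in> \<A> - {A}. A <+>\<^bsub>M\<^esub> B = A <+>\<^bsub>M\<^esub> B0}"
    using pigeonhole_infinite[of "\<A> - {A}" "\<lambda>B. A <+>\<^bsub>M\<^esub> B"] by auto
  \<comment> \<open>A nonzero intersection of two simple submodules equals both of them,
    contradicting \<open>B \<noteq> A\<close>.\<close>
  have disj: "A \<inter> B = {\<zero>\<^bsub>M\<^esub>}" if B: "B \<in> \<A> - {A}" for B
  proof (rule ccontr)
    assume nz: "A \<inter> B \<noteq> {\<zero>\<^bsub>M\<^esub>}"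
    have subB: "submodule B R M" and simB: "simple_module R (restrict_module M B)"
      using B by (auto simp: \<A>_def submodules_def)
    have "submodule (A \<inter> B) R M" by (rule submodule_Int[OF subA subB])
    then have "A \<inter> B = A" "A \<inter> B = B"
      using simA simB nz
      by (auto simp: simple_module_def submodules_def submodule_restrict_iff subA subB)
    then show False using B by auto
  qed
  have "infinite {B \<in> submodules R M. simple_module R (restrict_module M B) \<and>
      A \<inter> B = {\<zero>\<^bsub>M\<^esub>} \<and> A <+>\<^bsub>M\<^esub> B = A <+>\<^bsub>M\<^esub> B0}"
    by (rule infinite_super[OF _ infB]) (use disj in \<open>auto simp: \<A>_def\<close>)
  from infinite_complements[OF subA simA this] subA simA show ?thesis
    using B0 submodule_set_add[OF subA, of B0] by (auto simp: \<A>_def submodules_def)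
qed

end

section \<open>Passage to a critical quotient\<close>

theorem proposition12:
  fixes R :: "('a, 'r) ring_scheme"
    and M :: "('a, 'b, 'm) module_scheme"
  assumes "ring R"
    and "left_module R M"
    and "finite_length R M"
    and "infinite (submodules R M)"
  shows "\<exists>(S :: ('a, 'b set) module) K L.
           simple_module R S \<and>
           K \<in> submodules R M \<and>
           L \<in> submodules R (quot_module M K) \<and>
           isomorphic_modules R (restrict_module (quot_module M K) L) (dsum_module S S) \<and>
           infinite (carrier (End_ring R S))"
proof -
  interpret left_module R M by fact
  obtain n F where cs: "composition_series R M n F"
    using assms(3) by (auto simp: finite_length_def)
  define rk where "rk N = card {i. i < n \<and> \<not> N \<inter> F (Suc i) \<subseteq> F i}" for N
  have rk_less: "rk N < rk N'" if "submodule N R M" "submodule N' R M" "N \<subset> N'" for N N'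
    using composition_series_rank[OF cs that] by (simp add: rk_def)
  have rk_le: "rk N \<le> n" for N
    using card_mono[of "{..<n}" "{i. i < n \<and> \<not> N \<inter> F (Suc i) \<subseteq> F i}"] by (auto simp: rk_def)
  define above where "above K = {N \<in> submodules R M. K \<subseteq> N}" for K
  define P where "P K \<longleftrightarrow> submodule K R M \<and> infinite (above K)" for K
  have "above {\<zero>\<^bsub>M\<^esub>} = submodules R M"
    using submoduleD(2) by (auto simp: above_def submodules_def)
  then have "P {\<zero>\<^bsub>M\<^esub>}" using zero_submodule assms(4) by (simp add: P_def)
  \<comment> \<open>The rank is bounded by \<open>n\<close>, so it attains a greatest value on the
    submodules with infinitely many submodules above them.\<close>
  then obtain K where K: "P K" "\<And>N. P N \<Longrightarrow> rk N \<le> rk K"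
    using ex_has_greatest_nat[of P "{\<zero>\<^bsub>M\<^esub>}" rk "Suc n"] rk_le le_imp_less_Suc by blast
  have subK: "submodule K R M" and infK: "infinite (above K)" using K by (auto simp: P_def)
  have fin: "finite (above N)" if "submodule N R M" "K \<subset> N" for N
    using K(2)[of N] rk_less[OF subK that] that by (auto simp: P_def)
  let ?Q = "quot_module M K"
  let ?im = "\<lambda>N. (\<lambda>x. K +>\<^bsub>M\<^esub> x) ` N" and ?pre = "\<lambda>X. {x \<in> carrier M. K +>\<^bsub>M\<^esub> x \<in> X}"
  interpret Q: left_module R ?Q by (rule quot_left_module[OF subK])
  note bij = bij_betw_submodules_quot[OF subK, folded above_def]
  note pre = preimage_quot_submodule[OF subK]
  have "\<exists>A C. submodule A R ?Q \<and> submodule C R ?Q \<and> simple_module R (restrict_module ?Q A) \<and>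
    isomorphic_modules R (restrict_module ?Q C)
      (dsum_module (restrict_module ?Q A) (restrict_module ?Q A)) \<and>
    infinite (carrier (End_ring R (restrict_module ?Q A)))"
  \<comment> \<open>Taking preimages is strictly monotone, because the image of the preimage of
    \<open>X\<close> is \<open>X\<close> again. Hence the rank on \<open>M\<close> induces one on
    the quotient.\<close>
  proof (rule Q.infinite_submodules_critical[of "\<lambda>X. rk (?pre X)"])
    fix X Y assume X: "submodule X R ?Q" and Y: "submodule Y R ?Q" and "X \<subset> Y"
    then have le: "?pre X \<subseteq> ?pre Y" and neq: "X \<noteq> Y" by auto
    have "?pre X \<noteq> ?pre Y"
    proof
      assume "?pre X = ?pre Y"
      then have "?im (?pre X) = ?im (?pre Y)" by (rule arg_cong)
      then show False using neq by (simp only: pre(3)[OF X] pre(3)[OF Y])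
    qed
    with le have "?pre X \<subset> ?pre Y" by (rule psubsetI)
    then show "rk (?pre X) < rk (?pre Y)" by (rule rk_less[OF pre(1)[OF X] pre(1)[OF Y]])
  next
    show "infinite (submodules R ?Q)" using bij_betw_finite[OF bij] infK by simp
  next
    fix X assume X: "submodule X R ?Q" "X \<noteq> {\<zero>\<^bsub>?Q\<^esub>}"
    \<comment> \<open>Otherwise every coset in \<open>X\<close> would be \<open>K\<close>, the zero
      of the quotient. So the preimage is strictly above \<open>K\<close>, where finiteness is
      known.\<close>
    have "?pre X \<noteq> K"
    proof
      assume "?pre X = K"
      moreover have "K +>\<^bsub>M\<^esub> x = K" if "x \<in> K" for x
        using abelian_subgroup.a_rcos_const[OF submodule_abelian_subgroup[OF subK] that] .
      ultimately have "X \<subseteq> {K}" using pre(3)[OF X(1)] by auto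
      then show False using X(2) Q.submoduleD(2)[OF X(1)] by (auto simp: zero_quot[OF subK])
    qed
    then have "finite (above (?pre X))" using pre(1,2)[OF X(1)] by (intro fin) auto
    moreover have "{Y \<in> submodules R ?Q. X \<subseteq> Y} \<subseteq> ?im ` above (?pre X)"
    proof
      fix Y assume "Y \<in> {Y \<in> submodules R ?Q. X \<subseteq> Y}"
      then have Y: "submodule Y R ?Q" "X \<subseteq> Y" by (auto simp: submodules_def)
      then have "?pre Y \<in> above (?pre X)"
        using pre(1)[OF Y(1)] by (auto simp: above_def submodules_def)
      then show "Y \<in> ?im ` above (?pre X)"
        by (rule rev_image_eqI) (rule pre(3)[OF Y(1), symmetric])
    qed
    ultimately show "finite {Y \<in> submodules R ?Q. X \<subseteq> Y}"
      using finite_subset finite_imageI by blast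
  qed
  then obtain A C where *: "submodule C R ?Q" "simple_module R (restrict_module ?Q A)"
    "isomorphic_modules R (restrict_module ?Q C)
      (dsum_module (restrict_module ?Q A) (restrict_module ?Q A))"
    "infinite (carrier (End_ring R (restrict_module ?Q A)))"
    by blast
  \<comment> \<open>The simple module is itself a submodule of the quotient, so its elements are
    cosets; hence the type \<open>'b set\<close>.\<close>
  show ?thesis
    using * subK
    by (intro exI[of _ "restrict_module ?Q A"] exI[of _ K] exI[of _ C]) (simp add: submodules_def)
qed

end
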